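(* Fix $b\in\{0,1\}^{\mathbb{N}}$ and a positive integer $N$. Let $f_1,f_2:\mathbb{N}^{\mathbb{N}}\to\mathbb{N}$ be defined by: $f_1(\alpha):=$ the least $n<N$ such that $\neg(\alpha_{n-1}<\alpha_n)\vee b_{\alpha_n}=1$ (first disjunct omitted for $n=0$), or $N-1$ if no such $n$ exists; and, with $n:=f_1(\alpha)$, $f_2(\alpha):=$ the least $y$ with $\alpha_n\le y\le\alpha_n+N-1$ and $b_y=0$ if $b_{\alpha_n}=1$ and such $y$ exists, and $\alpha_n+N-1$ otherwise. Let $\mathcal{A}_\omega$ be the two-oracle algorithm described in the context, run with oracles $\phi_1:=f_1$, $\phi_2:=f_2$. Then there is a run from the initial state $\langle[(\mathsf{s},0)],[\,]\mid\Box,\Box\rangle$ to an end state $\langle[\,],a\mid n,y\rangle$, and for $\alpha:=a::\mathbf{0}$: if $b_{\alpha_n}=1$ then $b_{\alpha_n}=b_{\alpha_n+1}=\dots=b_{\alpha_n+N-1}$; and if $b_{\alpha_n}=0$ then $\alpha_0<\alpha_1<\dots<\alpha_{N-1}$ and $b_{\alpha_0}=\dots=b_{\alpha_{N-1}}$.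
   Context: $\mathbb{N}^\ast$ (and $Z^\ast$) denotes finite sequences, $[\,]$ the empty sequence, $|\sigma|$ the length, $::$ extension/concatenation, $\mathbf{0}$ the constant zero sequence. $\Box$ is a fresh symbol. The algorithm $\mathcal{A}_\omega$: states are $\langle\sigma,a\mid o_1,o_2\rangle$ with $\sigma\in(\{\mathsf{s},\mathsf{e}_1,\mathsf{e}_2\}\times\mathbb{N})^\ast$, $a\in\mathbb{N}^\ast$, $o_1,o_2\in\mathbb{N}\cup\{\Box\}$; initial state $\langle[(\mathsf{s},0)],[\,]\mid\Box,\Box\rangle$; $Q_1$: states $\langle\sigma::(c,x),[\,]\mid\Box,\Box\rangle$ with $c\in\{\mathsf{s},\mathsf{e}_1\}$; $Q_2$: states $\langle\sigma,[\,]\mid n,\Box\rangle$ with $n<|\sigma|$; end states: $\langle[\,],a\mid n,y\rangle$ with $n,y\in\mathbb{N}$; $\xi_\omega(\sigma,a):=\sigma_2::a::\mathbf{0}$ where $\sigma_2$ is the sequence of second components of $\sigma$. Transitions: (a) $\langle\sigma::(c,x),[\,]\mid n,\Box\rangle\rhd_\omega\langle\sigma::(c,x)::(\mathsf{s},x+1),[\,]\mid\Box,\Box\rangle$; (b) $\langle\sigma::(\mathsf{e}_i,x),a\mid n,y\rangle\rhd_\omega\langle\sigma,x::a\mid n,y\rangle$; (c) $\langle\sigma::(\mathsf{s},x),a\mid n,y\rangle\rhd_\omega\langle\sigma::(\mathsf{e}_1,y),[\,]\mid\Box,\Box\rangle$ if $b_x=1\wedge x\le y\wedge b_y=0$, otherwise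 $\rhd_\omega\langle\sigma::(\mathsf{e}_2,x),a\mid n,y\rangle$. With oracles $\phi_1,\phi_2:\mathbb{N}^{\mathbb{N}}\to\mathbb{N}$: a state $\langle\sigma,a\mid\Box,\Box\rangle\in Q_1$ moves to $\langle\sigma,a\mid\phi_1(\xi_\omega(\sigma,a)),\Box\rangle$; a state $\langle\sigma,a\mid n,\Box\rangle\in Q_2$ moves to $\langle\sigma,a\mid n,\phi_2(\xi_\omega(\sigma,a))\rangle$; all other states move by $\rhd_\omega$. A run is a finite sequence of such moves in which no state before the last is an end state. *)

theory Defs
  imports Main "HOL-Library.Omega_Words_Fun"
begin

text \<open>
  Infinite sequences are functions on \<open>nat\<close>; \<open>a \<frown> (\<lambda>_. 0)\<close> is \<open>a :: \<zero>\<close>, the finite sequence \<open>a\<close>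
  continued by the constant zero sequence.
\<close>

datatype label = S | E1 | E2

text \<open>
  \<open>State \<sigma> a o\<^sub>1 o\<^sub>2\<close> is \<open>\<langle>\<sigma>, a | o\<^sub>1, o\<^sub>2\<rangle>\<close>, with \<open>None\<close> in the role of the fresh symbol \<open>\<box>\<close>.
  The sequence \<open>\<sigma>\<close> is written left to right, so its right end, where the algorithm operates,
  is the last list element.
\<close>

datatype state = State "(label \<times> nat) list" "nat list" "nat option" "nat option"

definition init_state :: state where
  "init_state = State [(S, 0)] [] None None"

definition Q1 :: "state set" where
  "Q1 = {State (\<sigma> @ [(c, x)]) [] None None | \<sigma> c x. c \<in> {S, E1}}"

definition Q2 :: "state set" where
  "Q2 = {State \<sigma> [] (Some n) None | \<sigma> n. n < length \<sigma>}"

definition end_states :: "state set" where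
  "end_states = {State [] a (Some n) (Some y) | a n y. True}"

definition \<xi> :: "(label \<times> nat) list \<Rightarrow> nat list \<Rightarrow> (nat \<Rightarrow> nat)" where
  "\<xi> \<sigma> a = map snd \<sigma> \<frown> a \<frown> (\<lambda>_. 0)"

inductive trans_step :: "(nat \<Rightarrow> nat) \<Rightarrow> state \<Rightarrow> state \<Rightarrow> bool" for b where
  extend:
    "trans_step b (State (\<sigma> @ [(c, x)]) [] (Some n) None)
                  (State (\<sigma> @ [(c, x), (S, x + 1)]) [] None None)"
| pop:
    "e \<in> {E1, E2} \<Longrightarrow>
     trans_step b (State (\<sigma> @ [(e, x)]) a (Some n) (Some y))
                  (State \<sigma> (x # a) (Some n) (Some y))"
| replace:
    "b x = 1 \<and> x \<le> y \<and> b y = 0 \<Longrightarrow>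
     trans_step b (State (\<sigma> @ [(S, x)]) a (Some n) (Some y))
                  (State (\<sigma> @ [(E1, y)]) [] None None)"
| mark:
    "\<not> (b x = 1 \<and> x \<le> y \<and> b y = 0) \<Longrightarrow>
     trans_step b (State (\<sigma> @ [(S, x)]) a (Some n) (Some y))
                  (State (\<sigma> @ [(E2, x)]) a (Some n) (Some y))"

inductive move ::
  "(nat \<Rightarrow> nat) \<Rightarrow> ((nat \<Rightarrow> nat) \<Rightarrow> nat) \<Rightarrow> ((nat \<Rightarrow> nat) \<Rightarrow> nat) \<Rightarrow> state \<Rightarrow> state \<Rightarrow> bool"
  for b \<phi>\<^sub>1 \<phi>\<^sub>2 where
  query1:
    "State \<sigma> a None None \<in> Q1 \<Longrightarrow>
     move b \<phi>\<^sub>1 \<phi>\<^sub>2 (State \<sigma> a None None) (State \<sigma> a (Some (\<phi>\<^sub>1 (\<xi> \<sigma> a))) None)"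
| query2:
    "State \<sigma> a (Some n) None \<in> Q2 \<Longrightarrow>
     move b \<phi>\<^sub>1 \<phi>\<^sub>2 (State \<sigma> a (Some n) None) (State \<sigma> a (Some n) (Some (\<phi>\<^sub>2 (\<xi> \<sigma> a))))"
| internal:
    "s \<notin> Q1 \<union> Q2 \<Longrightarrow> trans_step b s s' \<Longrightarrow> move b \<phi>\<^sub>1 \<phi>\<^sub>2 s s'"

definition is_run ::
  "(nat \<Rightarrow> nat) \<Rightarrow> ((nat \<Rightarrow> nat) \<Rightarrow> nat) \<Rightarrow> ((nat \<Rightarrow> nat) \<Rightarrow> nat) \<Rightarrow> state list \<Rightarrow> bool" where
  "is_run b \<phi>\<^sub>1 \<phi>\<^sub>2 ss \<longleftrightarrow>
     ss \<noteq> [] \<and>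
     (\<forall>i. Suc i < length ss \<longrightarrow> ss ! i \<notin> end_states \<and> move b \<phi>\<^sub>1 \<phi>\<^sub>2 (ss ! i) (ss ! Suc i))"

definition f1 :: "(nat \<Rightarrow> nat) \<Rightarrow> nat \<Rightarrow> (nat \<Rightarrow> nat) \<Rightarrow> nat" where
  "f1 b N \<alpha> =
     (let P = (\<lambda>n. n < N \<and> (n \<noteq> 0 \<and> \<not> \<alpha> (n - 1) < \<alpha> n \<or> b (\<alpha> n) = 1))
      in if \<exists>n. P n then LEAST n. P n else N - 1)"

definition f2 :: "(nat \<Rightarrow> nat) \<Rightarrow> nat \<Rightarrow> (nat \<Rightarrow> nat) \<Rightarrow> nat" where
  "f2 b N \<alpha> =
     (let n = f1 b N \<alpha>;
          P = (\<lambda>y. \<alpha> n \<le> y \<and> y \<le> \<alpha> n + N - 1 \<and> b y = 0)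
      in if b (\<alpha> n) = 1 \<and> (\<exists>y. P y) then LEAST y. P y else \<alpha> n + N - 1)"

end

theory Submission
  imports Defs
begin

text \<open>
  Between two restarts the algorithm either appends an entry labelled \<open>S\<close>, or sweeps from the right
  end to the left for the last \<open>S\<close>-entry \<open>x\<close> for which the answer \<open>y\<close> of the second oracle shows
  that \<open>b\<close> is not constantly \<open>1\<close> from \<open>x\<close> on, turns it into the \<open>E1\<close>-entry \<open>y\<close> and discards
  everything to its right. Ordering the contents of a position by \<open>E1 < S < absent\<close>, every restart
  decreases the sequence of labels lexicographically, and since the first oracle answers less than
  \<open>N\<close>, the length never exceeds \<open>N\<close>; so eventually a sweep finds nothing and reaches an end state.
  At every restart the entries increase strictly and \<open>b\<close> vanishes at the \<open>E1\<close>-entries; together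
  with the failure of the last sweep this forces the required properties.
\<close>

section \<open>Runs as paths of moves\<close>

definition active_move ::
  "(nat \<Rightarrow> nat) \<Rightarrow> ((nat \<Rightarrow> nat) \<Rightarrow> nat) \<Rightarrow> ((nat \<Rightarrow> nat) \<Rightarrow> nat) \<Rightarrow> state \<Rightarrow> state \<Rightarrow> bool" where
  "active_move b \<phi>\<^sub>1 \<phi>\<^sub>2 s s' \<longleftrightarrow> s \<notin> end_states \<and> move b \<phi>\<^sub>1 \<phi>\<^sub>2 s s'"

abbreviation reaches ::
  "(nat \<Rightarrow> nat) \<Rightarrow> ((nat \<Rightarrow> nat) \<Rightarrow> nat) \<Rightarrow> ((nat \<Rightarrow> nat) \<Rightarrow> nat) \<Rightarrow> state \<Rightarrow> state \<Rightarrow> bool" where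
  "reaches b \<phi>\<^sub>1 \<phi>\<^sub>2 \<equiv> (active_move b \<phi>\<^sub>1 \<phi>\<^sub>2)\<^sup>*\<^sup>*"

text \<open>Every source of an \<open>active_move\<close> is a non-end state, so the states along
  such a path already satisfy the condition on runs.\<close>

lemma reaches_imp_run:
  assumes "reaches b \<phi>\<^sub>1 \<phi>\<^sub>2 s s'"
  shows "\<exists>ss. is_run b \<phi>\<^sub>1 \<phi>\<^sub>2 ss \<and> hd ss = s \<and> last ss = s'"
  using assms
proof (induction rule: converse_rtranclp_induct)
  case base
  show ?case by (rule exI[of _ "[s']"]) (simp add: is_run_def)
next
  case (step s t)
  then obtain ss where ss: "is_run b \<phi>\<^sub>1 \<phi>\<^sub>2 ss" "hd ss = t" "last ss = s'" by blast
  then have "ss \<noteq> []" by (simp add: is_run_def)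
  have "is_run b \<phi>\<^sub>1 \<phi>\<^sub>2 (s # ss)"
    unfolding is_run_def
  proof (intro conjI allI impI)
    fix i assume "Suc i < length (s # ss)"
    then have "(s # ss) ! i \<notin> end_states \<and> move b \<phi>\<^sub>1 \<phi>\<^sub>2 ((s # ss) ! i) ((s # ss) ! Suc i)"
      using ss step.hyps(1) \<open>ss \<noteq> []\<close>
      by (cases i) (auto simp: is_run_def active_move_def hd_conv_nth)
    then show "(s # ss) ! i \<notin> end_states"
      and "move b \<phi>\<^sub>1 \<phi>\<^sub>2 ((s # ss) ! i) ((s # ss) ! Suc i)" by auto
  qed simp
  then show ?case using ss \<open>ss \<noteq> []\<close> by (intro exI[of _ "s # ss"]) simp
qed

lemma active_move_query1:
  assumes "c \<in> {S, E1}"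
  shows "active_move b \<phi>\<^sub>1 \<phi>\<^sub>2 (State (\<sigma> @ [(c, x)]) [] None None)
           (State (\<sigma> @ [(c, x)]) [] (Some (\<phi>\<^sub>1 (\<xi> (\<sigma> @ [(c, x)]) []))) None)"
  unfolding active_move_def using assms
  by (auto simp: end_states_def Q1_def intro!: move.query1)

lemma active_move_query2:
  assumes "n < length \<sigma>"
  shows "active_move b \<phi>\<^sub>1 \<phi>\<^sub>2 (State \<sigma> [] (Some n) None)
           (State \<sigma> [] (Some n) (Some (\<phi>\<^sub>2 (\<xi> \<sigma> []))))"
  unfolding active_move_def using assms
  by (auto simp: end_states_def Q2_def intro!: move.query2)

text \<open>The side conditions exclude the competing cases one by one:
  \<open>o\<^sub>1 = Some n\<close> keeps the state out of \<open>Q1\<close>, the condition on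
  \<open>o\<^sub>2\<close> keeps it out of \<open>Q2\<close>, and a nonempty \<sigma> keeps it from
  being an end state.\<close>

lemma active_move_internal:
  assumes "trans_step b (State \<sigma> a o\<^sub>1 o\<^sub>2) s"
    and "o\<^sub>1 = Some n" and "o\<^sub>2 \<noteq> None \<or> length \<sigma> \<le> n" and "\<sigma> \<noteq> []"
  shows "active_move b \<phi>\<^sub>1 \<phi>\<^sub>2 (State \<sigma> a o\<^sub>1 o\<^sub>2) s"
  unfolding active_move_def using assms
  by (auto simp: end_states_def Q1_def Q2_def intro!: move.internal)

section \<open>The sweep from right to left\<close>

definition improvable :: "(nat \<Rightarrow> nat) \<Rightarrow> nat \<Rightarrow> nat \<Rightarrow> bool" where
  "improvable b y x \<longleftrightarrow> b x = 1 \<and> x \<le> y \<and> b y = 0"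

text \<open>The induction removes the rightmost entry. The list \<open>a\<close> has to vary because
  it collects the popped entries, whereas \<open>n\<close> and \<open>y\<close> stay fixed during a
  sweep.\<close>

lemma sweep:
  assumes "fst ` set \<sigma> \<subseteq> {S, E1}"
  shows "(\<exists>\<tau> x \<rho>. \<sigma> = \<tau> @ (S, x) # \<rho> \<and> improvable b y x \<and>
            reaches b \<phi>\<^sub>1 \<phi>\<^sub>2 (State \<sigma> a (Some n) (Some y)) (State (\<tau> @ [(E1, y)]) [] None None))
       \<or> (\<forall>x. (S, x) \<in> set \<sigma> \<longrightarrow> \<not> improvable b y x) \<and>
            reaches b \<phi>\<^sub>1 \<phi>\<^sub>2 (State \<sigma> a (Some n) (Some y))
              (State [] (map snd \<sigma> @ a) (Some n) (Some y))"
  using assms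
proof (induction \<sigma> arbitrary: a rule: rev_induct)
  case Nil
  show ?case by simp
next
  case (snoc p \<sigma>)
  obtain c x where p: "p = (c, x)" by force
  show ?case
  proof (cases "c = S \<and> improvable b y x")
    case True
    then have "active_move b \<phi>\<^sub>1 \<phi>\<^sub>2 (State (\<sigma> @ [p]) a (Some n) (Some y))
                 (State (\<sigma> @ [(E1, y)]) [] None None)"
      unfolding p improvable_def by (auto intro!: active_move_internal trans_step.replace)
    then show ?thesis using True p by blast
  next
    case False
    have "reaches b \<phi>\<^sub>1 \<phi>\<^sub>2 (State (\<sigma> @ [p]) a (Some n) (Some y))
            (State \<sigma> (x # a) (Some n) (Some y))"
    proof (cases "c = S")
      case True
      \<comment> \<open>The label \<open>E2\<close> is transient: marking is followed at once by a
        pop, so the remaining entries carry only \<open>S\<close> and \<open>E1\<close>.\<close>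
      then have "active_move b \<phi>\<^sub>1 \<phi>\<^sub>2 (State (\<sigma> @ [p]) a (Some n) (Some y))
                   (State (\<sigma> @ [(E2, x)]) a (Some n) (Some y))"
        using False unfolding p improvable_def
        by (auto intro!: active_move_internal trans_step.mark)
      moreover have "active_move b \<phi>\<^sub>1 \<phi>\<^sub>2 (State (\<sigma> @ [(E2, x)]) a (Some n) (Some y))
                   (State \<sigma> (x # a) (Some n) (Some y))"
        by (auto intro!: active_move_internal trans_step.pop)
      ultimately show ?thesis by (meson converse_rtranclp_into_rtranclp r_into_rtranclp)
    next
      case False
      then have "c = E1" using snoc.prems p by auto
      then have "active_move b \<phi>\<^sub>1 \<phi>\<^sub>2 (State (\<sigma> @ [p]) a (Some n) (Some y))
                   (State \<sigma> (x # a) (Some n) (Some y))"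
        unfolding p by (auto intro!: active_move_internal trans_step.pop)
      then show ?thesis by blast
    qed
    note pop = rtranclp_trans[OF this]
    have "fst ` set \<sigma> \<subseteq> {S, E1}" using snoc.prems by auto
    from snoc.IH[OF this, of "x # a"] show ?thesis
    proof (elim disjE exE conjE)
      fix \<tau> z \<rho>
      assume "\<sigma> = \<tau> @ (S, z) # \<rho>" "improvable b y z"
        "reaches b \<phi>\<^sub>1 \<phi>\<^sub>2 (State \<sigma> (x # a) (Some n) (Some y)) (State (\<tau> @ [(E1, y)]) [] None None)"
      then show ?thesis using pop
        by (intro disjI1 exI[of _ \<tau>] exI[of _ z] exI[of _ "\<rho> @ [p]"]) auto
    next
      assume "\<forall>x. (S, x) \<in> set \<sigma> \<longrightarrow> \<not> improvable b y x"
        "reaches b \<phi>\<^sub>1 \<phi>\<^sub>2 (State \<sigma> (x # a) (Some n) (Some y))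
           (State [] (map snd \<sigma> @ x # a) (Some n) (Some y))"
      then show ?thesis using pop False p by (intro disjI2) auto
    qed
  qed
qed

section \<open>Invariant and termination measure at restarts\<close>

definition wellformed :: "(nat \<Rightarrow> nat) \<Rightarrow> nat \<Rightarrow> (label \<times> nat) list \<Rightarrow> bool" where
  "wellformed b N \<sigma> \<longleftrightarrow> \<sigma> \<noteq> [] \<and> length \<sigma> \<le> N \<and> fst ` set \<sigma> \<subseteq> {S, E1} \<and>
     (\<forall>x. (E1, x) \<in> set \<sigma> \<longrightarrow> b x = 0) \<and> sorted_wrt (<) (map snd \<sigma>)"

lemma wellformed_extend:
  assumes "wellformed b N (\<sigma> @ [(c, x)])" and "Suc (length \<sigma>) < N"
  shows "wellformed b N (\<sigma> @ [(c, x), (S, x + 1)])"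
  using assms unfolding wellformed_def by (fastforce simp: sorted_wrt_append)

text \<open>As \<open>x \<le> y\<close>, the new last entry exceeds everything in \<tau>. The later
  entries, which \<open>y\<close> need not be below, are discarded.\<close>

lemma wellformed_replace:
  assumes "wellformed b N (\<tau> @ (S, x) # \<rho>)" and "improvable b y x"
  shows "wellformed b N (\<tau> @ [(E1, y)])"
  using assms unfolding wellformed_def improvable_def by (fastforce simp: sorted_wrt_append)

text \<open>The code \<open>2\<close> stands for an absent position; padding to length \<open>N\<close> makes the codes comparable
  by the lexicographic order on lists of equal length.\<close>

definition progress_code :: "nat \<Rightarrow> (label \<times> nat) list \<Rightarrow> nat list" where
  "progress_code N \<sigma> =
     map (\<lambda>(c, x). if c = S then 1 else 0) \<sigma> @ replicate (N - length \<sigma>) 2"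

lemma progress_code_extend:
  assumes "length \<sigma> < N"
  shows "(progress_code N (\<sigma> @ [(S, x)]), progress_code N \<sigma>) \<in> lex less_than"
proof -
  \<comment> \<open>Splitting off one padding entry exposes the position whose code drops from 2 to
    1.\<close>
  have "N - length \<sigma> = Suc (N - Suc (length \<sigma>))" using assms by simp
  then show ?thesis unfolding progress_code_def by (simp add: lex_append_leftI)
qed

text \<open>The position of \<open>x\<close> drops from 1 to 0, which outweighs the return of all
  later positions to 2.\<close>

lemma progress_code_replace:
  assumes "length (\<tau> @ (S, x) # \<rho>) \<le> N"
  shows "(progress_code N (\<tau> @ [(E1, y)]), progress_code N (\<tau> @ (S, x) # \<rho>)) \<in> lex less_than"
  unfolding progress_code_def using assms by (simp add: lex_append_leftI)

section \<open>The two oracles\<close>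

text \<open>A successful search can also return \<open>N - 1\<close>, so the cases are split by
  whether the search succeeds; only its failure gives information on all positions.\<close>

lemma f1_cases:
  assumes "f1 b N \<alpha> = n"
  obtains "n \<noteq> 0 \<and> \<not> \<alpha> (n - 1) < \<alpha> n \<or> b (\<alpha> n) = 1"
  | "n = N - 1" and "\<And>m. m < N \<Longrightarrow> (m = 0 \<or> \<alpha> (m - 1) < \<alpha> m) \<and> b (\<alpha> m) \<noteq> 1"
proof (cases "\<exists>n. n < N \<and> (n \<noteq> 0 \<and> \<not> \<alpha> (n - 1) < \<alpha> n \<or> b (\<alpha> n) = 1)")
  case True
  then show thesis using that(1) LeastI_ex[OF True] assms by (simp add: f1_def)
next
  case False
  then have "n = N - 1" using assms unfolding f1_def Let_def by (simp only: if_False)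
  then show thesis using that(2) False by blast
qed

lemma f1_less:
  assumes "N > 0"
  shows "f1 b N \<alpha> < N"
proof (cases "\<exists>n. n < N \<and> (n \<noteq> 0 \<and> \<not> \<alpha> (n - 1) < \<alpha> n \<or> b (\<alpha> n) = 1)")
  case True
  then show ?thesis using LeastI_ex[OF True] by (simp add: f1_def)
next
  case False
  then have "f1 b N \<alpha> = N - 1" unfolding f1_def Let_def by (simp only: if_False)
  then show ?thesis using assms by simp
qed

text \<open>The witness \<open>z\<close> makes the bounded search succeed, so the answer is a
  genuine zero of \<open>b\<close> and not the default value.\<close>

lemma f2_zero:
  assumes "b (\<alpha> (f1 b N \<alpha>)) = 1"
    and "\<alpha> (f1 b N \<alpha>) \<le> z" "z \<le> \<alpha> (f1 b N \<alpha>) + N - 1" "b z = 0"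
  shows "\<alpha> (f1 b N \<alpha>) \<le> f2 b N \<alpha> \<and> b (f2 b N \<alpha>) = 0"
proof -
  let ?P = "\<lambda>y. \<alpha> (f1 b N \<alpha>) \<le> y \<and> y \<le> \<alpha> (f1 b N \<alpha>) + N - 1 \<and> b y = 0"
  have ex: "\<exists>y. ?P y" using assms by blast
  then have "f2 b N \<alpha> = (LEAST y. ?P y)" using assms(1) by (simp add: f2_def Let_def)
  then show ?thesis using LeastI_ex[OF ex] by simp
qed

section \<open>Correctness and termination\<close>

definition good_end :: "(nat \<Rightarrow> nat) \<Rightarrow> nat \<Rightarrow> nat \<Rightarrow> (nat \<Rightarrow> nat) \<Rightarrow> bool" where
  "good_end b N n \<alpha> \<longleftrightarrow>
     (b (\<alpha> n) = 1 \<longrightarrow> (\<forall>i<N. b (\<alpha> n + i) = b (\<alpha> n))) \<and>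
     (b (\<alpha> n) = 0 \<longrightarrow>
        (\<forall>i. i + 1 < N \<longrightarrow> \<alpha> i < \<alpha> (i + 1)) \<and> (\<forall>i<N. b (\<alpha> i) = b (\<alpha> 0)))"

text \<open>If \<open>b (\<alpha> n) = 1\<close>, a zero in the window above
  \<open>\<alpha> n\<close> would make \<open>f2\<close> return one, and the entry at
  \<open>n\<close> would be improvable. If \<open>b (\<alpha> n) = 0\<close>, the search of
  \<open>f1\<close> must have failed.\<close>

lemma good_end_if_not_improvable:
  fixes \<sigma> :: "(label \<times> nat) list"
  defines "\<alpha> \<equiv> map snd \<sigma> \<frown> (\<lambda>_. 0)"
  assumes b: "range b \<subseteq> {0, 1}" and wf: "wellformed b N \<sigma>"
    and n: "n = f1 b N \<alpha>" "n < length \<sigma>"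
    and max: "\<forall>x. (S, x) \<in> set \<sigma> \<longrightarrow> \<not> improvable b (f2 b N \<alpha>) x"
  shows "good_end b N n \<alpha>"
  unfolding good_end_def
proof (intro conjI impI)
  have b01: "b i = 0 \<or> b i = 1" for i using b by auto
  have nth: "\<alpha> i = snd (\<sigma> ! i)" if "i < length \<sigma>" for i
    using that by (simp add: \<alpha>_def conc_def)
  show "\<forall>i<N. b (\<alpha> n + i) = b (\<alpha> n)" if one: "b (\<alpha> n) = 1"
  proof (rule ccontr)
    assume "\<not> ?thesis"
    then obtain i where i: "i < N" "b (\<alpha> n + i) = 0" using one b01 by metis
    have "\<alpha> n \<le> f2 b N \<alpha> \<and> b (f2 b N \<alpha>) = 0"
      using f2_zero[of b \<alpha> N "\<alpha> n + i"] i one n(1) by simp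
    then have "improvable b (f2 b N \<alpha>) (\<alpha> n)" using one by (simp add: improvable_def)
    moreover have "(S, \<alpha> n) \<in> set \<sigma>"
    proof -
      have mem: "(fst (\<sigma> ! n), \<alpha> n) \<in> set \<sigma>" using n(2) by (simp add: nth)
      then have "fst (\<sigma> ! n) \<in> {S, E1}" using wf unfolding wellformed_def by force
      \<comment> \<open>An \<open>E1\<close>-entry would have \<open>b\<close>-value 0.\<close>
      moreover have "fst (\<sigma> ! n) \<noteq> E1" using mem wf one unfolding wellformed_def by auto
      ultimately show ?thesis using mem by auto
    qed
    ultimately show False using max by blast
  qed
  assume zero: "b (\<alpha> n) = 0"
  \<comment> \<open>Sortedness applies at \<open>n\<close> because
    \<open>n < length \<sigma>\<close>. With \<open>zero\<close> it leaves only the second case of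
    \<open>f1_cases\<close>.\<close>
  have "n = 0 \<or> \<alpha> (n - 1) < \<alpha> n"
    using wf n(2) unfolding wellformed_def sorted_wrt_iff_nth_less
    by (cases n) (auto simp: nth)
  then have *: "(m = 0 \<or> \<alpha> (m - 1) < \<alpha> m) \<and> b (\<alpha> m) \<noteq> 1" if "m < N" for m
    using f1_cases[OF n(1)[symmetric]] zero that by (metis zero_neq_one)
  show "\<forall>i. i + 1 < N \<longrightarrow> \<alpha> i < \<alpha> (i + 1)" using * by fastforce
  show "\<forall>i<N. b (\<alpha> i) = b (\<alpha> 0)" using * b01 by (metis gr_zeroI less_nat_zero_code)
qed

lemma reaches_good_end:
  assumes b: "range b \<subseteq> {0, 1}" and N: "N > 0" and "wellformed b N \<sigma>"
  shows "\<exists>a n y. reaches b (f1 b N) (f2 b N) (State \<sigma> [] None None) (State [] a (Some n) (Some y))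
           \<and> good_end b N n (a \<frown> (\<lambda>_. 0))"
  using assms(3)
proof (induction \<sigma> rule: wf_induct_rule[OF wf_inv_image[OF wf_lex[OF wf_less_than], of "progress_code N"]])
  case (1 \<sigma>)
  note wf = \<open>wellformed b N \<sigma>\<close>
  let ?reaches = "reaches b (f1 b N) (f2 b N)"
  let ?\<alpha> = "map snd \<sigma> \<frown> (\<lambda>_. 0)"
  define n where "n = f1 b N ?\<alpha>"
  define y where "y = f2 b N ?\<alpha>"
  have \<xi>: "\<xi> \<sigma> [] = ?\<alpha>" by (simp add: \<xi>_def)
  obtain \<sigma>' c x where \<sigma>: "\<sigma> = \<sigma>' @ [(c, x)]"
    using wf unfolding wellformed_def by (metis rev_exhaust surj_pair)
  have "c \<in> {S, E1}" using wf unfolding wellformed_def \<sigma> by auto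
  then have first: "?reaches (State \<sigma> [] None None) (State \<sigma> [] (Some n) None)"
    using active_move_query1[of c b "f1 b N" "f2 b N" \<sigma>' x] \<xi>
    unfolding \<sigma>[symmetric] n_def by auto
  \<comment> \<open>Both ways of continuing without reaching an end state close through this form of
    the induction hypothesis.\<close>
  have restart: ?case
    if "?reaches (State \<sigma> [] None None) (State \<tau> [] None None)"
      and "wellformed b N \<tau>" and "(progress_code N \<tau>, progress_code N \<sigma>) \<in> lex less_than" for \<tau>
    using 1(1)[of \<tau>] that by (meson in_inv_image rtranclp_trans)
  show ?case
  proof (cases "n < length \<sigma>")
    case False
    \<comment> \<open>The state lies outside \<open>Q2\<close>, so the sequence is extended; the
      bound on \<open>f1\<close> leaves room for one more entry.\<close>
    have "n < N" using f1_less[OF N] n_def by simp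
    then have len: "length \<sigma> < N" using False by simp
    have "active_move b (f1 b N) (f2 b N) (State \<sigma> [] (Some n) None)
            (State (\<sigma> @ [(S, x + 1)]) [] None None)"
      using trans_step.extend[of b \<sigma>' c x n] False
      by (intro active_move_internal) (auto simp: \<sigma>)
    with first have "?reaches (State \<sigma> [] None None) (State (\<sigma> @ [(S, x + 1)]) [] None None)"
      by (rule rtranclp.rtrancl_into_rtrancl)
    then show ?thesis
      using wellformed_extend[of b N \<sigma>' c x] wf len progress_code_extend[OF len]
      by (intro restart) (auto simp: \<sigma>)
  next
    case True
    then have "?reaches (State \<sigma> [] None None) (State \<sigma> [] (Some n) (Some y))"
      using active_move_query2[OF True, of b "f1 b N" "f2 b N"] first unfolding \<xi> y_def
      by (meson rtranclp.rtrancl_into_rtrancl)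
    note answered = rtranclp_trans[OF this]
    have "fst ` set \<sigma> \<subseteq> {S, E1}" using wf by (simp add: wellformed_def)
    from sweep[OF this, of b y "f1 b N" "f2 b N" "[]" n] show ?thesis
    proof (elim disjE exE conjE)
      fix \<tau> z \<rho>
      assume split: "\<sigma> = \<tau> @ (S, z) # \<rho>" and "improvable b y z"
        and reach: "?reaches (State \<sigma> [] (Some n) (Some y)) (State (\<tau> @ [(E1, y)]) [] None None)"
      then have "wellformed b N (\<tau> @ [(E1, y)])" using wf wellformed_replace by blast
      moreover have "(progress_code N (\<tau> @ [(E1, y)]), progress_code N \<sigma>) \<in> lex less_than"
        using progress_code_replace wf unfolding split wellformed_def by blast
      ultimately show ?thesis using answered[OF reach] by (intro restart)
    next
      assume "\<forall>x. (S, x) \<in> set \<sigma> \<longrightarrow> \<not> improvable b y x"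
        and reach: "?reaches (State \<sigma> [] (Some n) (Some y))
                      (State [] (map snd \<sigma> @ []) (Some n) (Some y))"
      \<comment> \<open>A full sweep turns the entries of \<sigma> into \<open>a\<close>, so the
        final sequence is the very one about which both oracles were asked.\<close>
      then have "good_end b N n ?\<alpha>"
        using good_end_if_not_improvable[OF b wf n_def True] y_def by simp
      then show ?thesis using answered[OF reach] by auto
    qed
  qed
qed

theorem theorem6p5:
  fixes b :: "nat \<Rightarrow> nat" and N :: nat
  assumes "range b \<subseteq> {0, 1}" and "N > 0"
  shows "\<exists>ss a n y.
           is_run b (f1 b N) (f2 b N) ss \<and> hd ss = init_state \<and>
           last ss = State [] a (Some n) (Some y) \<and>
           (let \<alpha> = a \<frown> (\<lambda>_. 0) in
              (b (\<alpha> n) = 1 \<longrightarrow> (\<forall>i<N. b (\<alpha> n + i) = b (\<alpha> n))) \<and>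
              (b (\<alpha> n) = 0 \<longrightarrow>
                 (\<forall>i. i + 1 < N \<longrightarrow> \<alpha> i < \<alpha> (i + 1)) \<and>
                 (\<forall>i<N. b (\<alpha> i) = b (\<alpha> 0))))"
proof -
  have "wellformed b N [(S, 0)]" using assms(2) by (auto simp: wellformed_def)
  then obtain a n y
    where reach: "reaches b (f1 b N) (f2 b N) init_state (State [] a (Some n) (Some y))"
      and good: "good_end b N n (a \<frown> (\<lambda>_. 0))"
    using reaches_good_end[OF assms] unfolding init_state_def by blast
  from reaches_imp_run[OF reach] good show ?thesis
    unfolding good_end_def Let_def by metis
qed

end
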